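(* Let $n\ge 2$, $\alpha\in(0,1)$, and let $\mathbf D_n=(Z_1,\dots,Z_n)$, $Z_i=(X_i,Y_i)$, be i.i.d. training data in $\mathcal X\times\mathcal Y$, with $(X_{\rm test},Y_{\rm test})$ an independent test point with the same distribution. Suppose that the training algorithm $T$ and the model $\{\mu_\beta\}_{\beta\in\mathbb R^p}$ satisfy the following three assumptions (all notation is as in the context): (A1) (uniform stability) for every sample size $k\ge 2$ and every $i\in\{1,\dots,k\}$, $$\sup_{z_1,\dots,z_k\in\mathcal X\times\mathcal Y}\big\|\mu_{T(z_1,\dots,z_{i-1},z_{i+1},\dots,z_k)}-\mu_{T(z_1,\dots,z_k)}\big\|_\infty\le \frac{c_k}{2};$$ (A2) (bi-Lipschitz parametrization) there are constants $\kappa_1>0$ and $\kappa_2<\infty$ such that $\kappa_1\|\beta-\beta'\|_\infty\le\|\mu_\beta-\mu_{\beta'}\|_\infty\le\kappa_2\|\beta-\beta'\|_\infty$ for all $\beta,\beta'\in\mathbb R^p$; (A3) (bounded density) for every $k$, the distribution function $F_k$ has a density $F_k'$ satisfying $F_k'<L_k$. Let $P_e(\mathbf D_n)=\mathbb P\big(Y_{\rm test}\notin\hat C_\alpha(X_{\rm test})\,\big|\,\mathbf D_n\big)$ be the training-conditional miscoverage rate of the full-conformal prediction region. Then for all $\epsilon,\delta>0$, $$\mathbb P\left(P_e(\mathbf D_n)>\alpha+\sqrt{\frac{\log(2/\delta)}{2n}}+L_n\left(c_{n+1}+\sqrt{2n\log\frac{2p}{\epsilon}}\;\frac{\kappa_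2\,c_n}{\kappa_1}\right)\right)\le\epsilon+\delta.$$
   Context: $\mathcal X$ is a measurable space and $\mathcal Y\subseteq\mathbb R$ is Borel. For each $\beta\in\mathbb R^p$ ($p\ge1$), $\mu_\beta:\mathcal X\to\mathbb R$ is a bounded measurable predictor function; $\|\mu\|_\infty=\sup_{x\in\mathcal X}|\mu(x)|$ for functions, and $\|\cdot\|_\infty$ is the max-norm on $\mathbb R^p$. A training algorithm is a measurable map $T:\bigcup_{k\ge1}(\mathcal X\times\mathcal Y)^k\to\mathbb R^p$; the fitted predictor on data $(z_1,\dots,z_k)$ is $\mu_{T(z_1,\dots,z_k)}$. The constants $c_k>0$ and $L_k$ are finite and may depend on the sample size $k$. Write $\overline\beta_k=\mathbb E\,T(Z_1,\dots,Z_k)$ (coordinatewise expectation, $Z_i$ i.i.d. from the data distribution), and $$F_k(t)=\mathbb P\big(|Y-\mu_{\overline\beta_k}(X)|\le t\big),$$ where $(X,Y)$ has the data distribution. Full-conformal region (with absolute-residual score): for $(x,y)\in\mathcal X\times\mathcal Y$ let $\hat\beta_{x,y}=T(Z_1,\dots,Z_n,(x,y))$, and let $\mathcal S(x,y)$ be the multiset of the $n+1$ scores $|Y_i-\mu_{\hat\beta_{x,y}}(X_i)|$, $i=1,\dots,n$, together with $|y-\mu_{\hat\beta_{x,y}}(x)|$. Let $\hat F^{-1}_{\mathcal S(x,y)}(1-\alpha)$ be the empirical $(1-\alpha)$-quantile of $\mathcal S(x,y)$, i.e. its $\lceil(1-\alpha)(n+1)\rceil$-th smallest element. Then $$\hat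 C_\alpha(x)=\big\{y\in\mathcal Y:\ |y-\mu_{\hat\beta_{x,y}}(x)|\le\hat F^{-1}_{\mathcal S(x,y)}(1-\alpha)\big\}.$$ A square root in the bound can have a negative argument only when $\epsilon+\delta\ge1$, in which case the inequality is regarded as trivially true. *)

theory Defs
  imports "HOL-Probability.Probability" "HOL-Library.Multiset"
begin

definition obs_space :: "'x measure \<Rightarrow> real set \<Rightarrow> ('x \<times> real) measure" where
  "obs_space MX Y = MX \<Otimes>\<^sub>M restrict_space borel Y"

text \<open>Meaningful for \<open>f\<close> bounded on a nonempty \<open>A\<close>, which is how it is used.\<close>

definition sup_norm_on :: "'x set \<Rightarrow> ('x \<Rightarrow> real) \<Rightarrow> real" where
  "sup_norm_on A f = (SUP x\<in>A. \<bar>f x\<bar>)"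

text \<open>
  A data set of size \<open>k\<close> is a list of length \<open>k\<close>, with indices \<open>0, \<dots>, k - 1\<close>. The list type also
  contains the empty list, on which the value of an algorithm is never used. A map on the disjoint
  union of the finite powers is measurable iff it is measurable on each of them.
\<close>

definition training_algorithm ::
    "('x \<times> real) measure \<Rightarrow> (('x \<times> real) list \<Rightarrow> real ^ 'p) \<Rightarrow> bool" where
  "training_algorithm S T \<longleftrightarrow>
     (\<forall>k\<ge>1. (\<lambda>z. T (map z [0..<k])) \<in> borel_measurable (Pi\<^sub>M {..<k} (\<lambda>_. S)))"

definition delete_nth :: "nat \<Rightarrow> 'a list \<Rightarrow> 'a list" where
  "delete_nth i zs = take i zs @ drop (Suc i) zs"

text \<open>The expectation of \<open>T (Z\<^sub>1, \<dots>, Z\<^sub>k)\<close> for an i.i.d. sample from \<open>D\<close>.\<close>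

definition mean_param ::
    "('x \<times> real) measure \<Rightarrow> (('x \<times> real) list \<Rightarrow> real ^ 'p) \<Rightarrow> nat \<Rightarrow> real ^ 'p" where
  "mean_param D T k =
     (\<chi> j. \<integral>z. T (map z [0..<k]) $ j \<partial>(Pi\<^sub>M {..<k} (\<lambda>_. D)))"

definition resid_cdf :: "('x \<times> real) measure \<Rightarrow> ('x \<Rightarrow> real) \<Rightarrow> real \<Rightarrow> real" where
  "resid_cdf D m t = \<P>(z in D. \<bar>snd z - m (fst z)\<bar> \<le> t)"

definition has_density :: "(real \<Rightarrow> real) \<Rightarrow> (real \<Rightarrow> real) \<Rightarrow> bool" where
  "has_density F f \<longleftrightarrow>
     integrable lborel f \<and> (\<forall>t. 0 \<le> f t) \<and> (\<forall>t. F t = (LBINT u:{..t}. f u))"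

text \<open>
  The \<open>\<lceil>q * size S\<rceil>\<close>-th smallest element of \<open>S\<close>, counted from one; list positions count from zero.
\<close>

definition emp_quantile :: "real multiset \<Rightarrow> real \<Rightarrow> real" where
  "emp_quantile S q = sorted_list_of_multiset S ! (nat \<lceil>q * real (size S)\<rceil> - 1)"

definition conformal_scores ::
    "((('x \<times> real) list) \<Rightarrow> real ^ 'p) \<Rightarrow> (real ^ 'p \<Rightarrow> 'x \<Rightarrow> real) \<Rightarrow>
      ('x \<times> real) list \<Rightarrow> 'x \<Rightarrow> real \<Rightarrow> real multiset" where
  "conformal_scores T mu zs x y =
     image_mset (\<lambda>(x', y'). \<bar>y' - mu (T (zs @ [(x, y)])) x'\<bar>) (mset (zs @ [(x, y)]))"

definition full_conformal ::
    "real set \<Rightarrow> ((('x \<times> real) list) \<Rightarrow> real ^ 'p) \<Rightarrow> (real ^ 'p \<Rightarrow> 'x \<Rightarrow> real) \<Rightarrow>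
      real \<Rightarrow> ('x \<times> real) list \<Rightarrow> 'x \<Rightarrow> real set" where
  "full_conformal Y T mu \<alpha> zs x =
     {y \<in> Y. \<bar>y - mu (T (zs @ [(x, y)])) x\<bar> \<le> emp_quantile (conformal_scores T mu zs x y) (1 - \<alpha>)}"

definition data_vec :: "nat \<Rightarrow> (nat \<Rightarrow> 'w \<Rightarrow> 'z) \<Rightarrow> 'w \<Rightarrow> nat \<Rightarrow> 'z" where
  "data_vec n Z w = (\<lambda>i\<in>{..<n}. Z i w)"

definition data_list :: "nat \<Rightarrow> (nat \<Rightarrow> 'w \<Rightarrow> 'z) \<Rightarrow> 'w \<Rightarrow> 'z list" where
  "data_list n Z w = map (\<lambda>i. Z i w) [0..<n]"

text \<open>
  Conditional probability of the event \<open>E\<close> given the sigma-algebra generated by the data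
  \<open>Z 0, \<dots>, Z (n - 1)\<close>, whose observations take values in \<open>S\<close>.
\<close>

definition cond_prob_data ::
    "'w measure \<Rightarrow> 'z measure \<Rightarrow> nat \<Rightarrow> (nat \<Rightarrow> 'w \<Rightarrow> 'z) \<Rightarrow> 'w set \<Rightarrow> 'w \<Rightarrow> real" where
  "cond_prob_data M S n Z E =
     real_cond_exp M (vimage_algebra (space M) (data_vec n Z) (Pi\<^sub>M {..<n} (\<lambda>_. S))) (indicat_real E)"

definition miscoverage ::
    "'w measure \<Rightarrow> 'x measure \<Rightarrow> real set \<Rightarrow> ((('x \<times> real) list) \<Rightarrow> real ^ 'p) \<Rightarrow>
      (real ^ 'p \<Rightarrow> 'x \<Rightarrow> real) \<Rightarrow> real \<Rightarrow> nat \<Rightarrow> (nat \<Rightarrow> 'w \<Rightarrow> 'x \<times> real) \<Rightarrow>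
      ('w \<Rightarrow> 'x \<times> real) \<Rightarrow> 'w \<Rightarrow> real" where
  "miscoverage M MX Y T mu \<alpha> n Z Ztest =
     cond_prob_data M (obs_space MX Y) n Z
       {w \<in> space M. snd (Ztest w) \<notin> full_conformal Y T mu \<alpha> (data_list n Z w) (fst (Ztest w))}"

end

theory Submission
  imports Defs
begin

text \<open>
  By stability and the lower Lipschitz bound, changing one observation moves each coordinate of the
  fitted parameter by at most \<open>c\<^sub>n / \<kappa>\<^sub>1\<close>, so McDiarmid's inequality and a union bound over the
  coordinates put it near its mean \<open>\<beta>\<^sub>0\<close> outside an event of probability \<open>\<epsilon>\<close>. There all scores of an augmented
  fit are within \<open>\<Delta> / 2\<close> of the residuals \<open>R\<close> of the fixed predictor with parameter \<open>\<beta>\<^sub>0\<close>, where \<open>L\<^sub>n * \<Delta>\<close> is the last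
  term of the bound. A miscovered test point thus has at least \<open>(1 - \<alpha>) n\<close> training residuals below
  \<open>R\<^sub>t\<^sub>e\<^sub>s\<^sub>t + \<Delta>\<close>.

  Uniform control of the empirical distribution function (the Dvoretzky--Kiefer--Wolfowitz inequality) is not
  needed. With \<open>\<eta>\<close> the square root term and \<open>u = 1 - \<alpha> - \<eta>\<close>, the event \<open>F (R\<^sub>t\<^sub>e\<^sub>s\<^sub>t + \<Delta>) < u\<close> would force \<open>F (R\<^sub>i) < u\<close>
  for at least \<open>(1 - \<alpha>) n\<close> indices, which a single binomial tail bound makes unlikely. Otherwise
  \<open>F (R\<^sub>t\<^sub>e\<^sub>s\<^sub>t) \<ge> u - L\<^sub>n * \<Delta>\<close>: this event does not involve the training data, and has probability at most
  \<open>1 - u + L\<^sub>n * \<Delta>\<close> because \<open>F (R\<^sub>t\<^sub>e\<^sub>s\<^sub>t)\<close> is uniform.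
\<close>

section \<open>Exponential moments and McDiarmid's inequality\<close>

text \<open>The coordinates of \<open>y\<close> are exchanged for those of \<open>x\<close> one at a
  time; the hybrid \<open>h J\<close> agrees with \<open>x\<close> on \<open>J\<close> and with
  \<open>y\<close> elsewhere. Hence a function with bounded differences is bounded, which makes it
  integrable below.\<close>

lemma bounded_differences_bound:
  assumes "finite I"
    and x: "x \<in> space (PiM I M)" and y: "y \<in> space (PiM I M)"
    and diff: "\<And>x i y. x \<in> space (PiM I M) \<Longrightarrow> i \<in> I \<Longrightarrow> y \<in> space (M i) \<Longrightarrow>
      \<bar>f (x(i := y)) - f x\<bar> \<le> (c i :: real)"
  shows "\<bar>f x - f y\<bar> \<le> (\<Sum>i\<in>I. c i)"
proof -
  define h where "h J = (\<lambda>i. if i \<in> J then x i else y i)" for J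
  have h_space: "h J \<in> space (PiM I M)" if "J \<subseteq> I" for J
    using x y that by (auto simp: h_def space_PiM PiE_def extensional_def Pi_def)
  have "J \<subseteq> I \<Longrightarrow> \<bar>f (h J) - f y\<bar> \<le> (\<Sum>i\<in>J. c i)" if "finite J" for J
    using that
  proof (induction J)
    case empty
    show ?case by (simp add: h_def)
  next
    case (insert j J)
    have "h (insert j J) = (h J)(j := x j)"
      by (auto simp: h_def)
    moreover have "x j \<in> space (M j)"
      using x insert.prems by (auto simp: space_PiM)
    ultimately have "\<bar>f (h (insert j J)) - f (h J)\<bar> \<le> c j"
      using diff[OF h_space] insert.prems by auto
    with insert show ?case by auto
  qed
  moreover have "h I = x"
    using x y by (fastforce simp: h_def space_PiM PiE_def extensional_def)
  ultimately show ?thesis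
    using \<open>finite I\<close> by auto
qed

lemma integrable_bounded_differences:
  assumes "finite I" and M: "\<And>i. prob_space (M i)" and f: "f \<in> borel_measurable (PiM I M)"
    and diff: "\<And>x i y. x \<in> space (PiM I M) \<Longrightarrow> i \<in> I \<Longrightarrow> y \<in> space (M i) \<Longrightarrow>
      \<bar>f (x(i := y)) - f x\<bar> \<le> (c i :: real)"
  shows "integrable (PiM I M) f"
proof -
  interpret P: prob_space "PiM I M"
    by (intro prob_space_PiM M)
  obtain x where x: "x \<in> space (PiM I M)"
    using P.not_empty by blast
  show ?thesis
    using bounded_differences_bound[OF \<open>finite I\<close> _ x diff]
    by (intro P.integrable_const_bound[where B = "\<bar>f x\<bar> + (\<Sum>i\<in>I. c i)"] AE_I2 f) fastforce
qed

text \<open>Coordinates are integrated out one at a time. With the others fixed, \<open>f\<close>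
  ranges over an interval of length \<open>c i\<close>, so Hoeffding's lemma yields the factor
  \<open>exp (l\<^sup>2 * (c i)\<^sup>2 / 8)\<close>. The average \<open>g\<close> over coordinate
  \<open>i\<close> keeps the mean of \<open>f\<close> and its difference bounds for the remaining
  coordinates, so the induction hypothesis applies to it.\<close>

lemma bounded_differences_exp_moment:
  assumes "finite I" and M: "\<And>i. prob_space (M i)" and "f \<in> borel_measurable (PiM I M)"
    and "\<And>x i y. x \<in> space (PiM I M) \<Longrightarrow> i \<in> I \<Longrightarrow> y \<in> space (M i) \<Longrightarrow>
      \<bar>f (x(i := y)) - f x\<bar> \<le> (c i :: real)"
    and l: "0 < l"
  shows "(\<integral>\<^sup>+x. ennreal (exp (l * (f x - integral\<^sup>L (PiM I M) f))) \<partial>PiM I M) \<le>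
           ennreal (exp (l\<^sup>2 * (\<Sum>i\<in>I. (c i)\<^sup>2) / 8))"
  using assms(1,3,4)
proof (induction I arbitrary: f rule: finite_induct)
  case (empty f)
  show ?case
    by (simp add: PiM_empty lebesgue_integral_count_space_finite nn_integral_count_space_finite)
next
  case (insert i I f)
  note [measurable] = insert.prems(1)
  interpret product_prob_space M
    by (rule product_prob_spaceI) (rule M)
  define \<mu> where "\<mu> = integral\<^sup>L (PiM (insert i I) M) f"
  define g where "g x = (\<integral>y. f (x(i := y)) \<partial>M i)" for x
  have upd: "x(i := y) \<in> space (PiM (insert i I) M)"
    if "x \<in> space (PiM I M)" "y \<in> space (M i)" for x y
    using that by (auto simp: space_PiM PiE_def extensional_def Pi_def)
  have slice: "interval_bounded_random_variable (M i) (\<lambda>y. f (x(i := y)))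
      (INF y\<in>space (M i). f (x(i := y))) ((INF y\<in>space (M i). f (x(i := y))) + c i)"
    if x: "x \<in> space (PiM I M)" for x
  proof
    show "(\<lambda>y. f (x(i := y))) \<in> borel_measurable (M i)"
      using x by measurable
    \<comment> \<open>The hypothesis compares a point with its update. Two values of the slice are
      compared by taking one of them as the base point: updating coordinate \<open>i\<close> again
      overwrites it.\<close>
    have diff: "\<bar>f (x(i := y)) - f (x(i := y'))\<bar> \<le> c i"
      if "y \<in> space (M i)" "y' \<in> space (M i)" for y y'
    proof -
      have "\<bar>f ((x(i := y'))(i := y)) - f (x(i := y'))\<bar> \<le> c i"
        by (rule insert.prems(2)[OF upd[OF x that(2)] insertI1 that(1)])
      then show ?thesis by (simp only: fun_upd_upd)
    qed
    have bdd: "bdd_below ((\<lambda>y. f (x(i := y))) ` space (M i))"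
    proof -
      obtain y0 where "y0 \<in> space (M i)" using M.not_empty by blast
      then show ?thesis
        using diff[of _ y0] by (intro bdd_belowI2[where m = "f (x(i := y0)) - c i"]) fastforce
    qed
    have "f (x(i := y)) - c i \<le> (INF y\<in>space (M i). f (x(i := y)))" if "y \<in> space (M i)" for y
      using diff[OF that] by (intro cINF_greatest M.not_empty) fastforce
    then show "AE y in M i. f (x(i := y)) \<in>
        {INF y\<in>space (M i). f (x(i := y))..(INF y\<in>space (M i). f (x(i := y))) + c i}"
      by (intro AE_I2) (auto intro: cINF_lower[OF bdd] simp: algebra_simps)
  qed
  have g [measurable]: "g \<in> borel_measurable (PiM I M)"
    unfolding g_def by measurable
  have int_f: "integrable (PiM (insert i I) M) f"
    by (rule integrable_bounded_differences[OF _ M insert.prems]) (use insert.hyps in auto)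
  have \<mu>: "integral\<^sup>L (PiM I M) g = \<mu>"
    unfolding \<mu>_def g_def using product_integral_insert[OF insert.hyps int_f] by simp
  have diff_g: "\<bar>g (x(j := z)) - g x\<bar> \<le> c j"
    if x: "x \<in> space (PiM I M)" and j: "j \<in> I" and z: "z \<in> space (M j)" for x j z
  proof -
    have xz: "x(j := z) \<in> space (PiM I M)"
      using x j z by (auto simp: space_PiM PiE_def extensional_def Pi_def)
    note int = slice[THEN interval_bounded_random_variable.integrable]
    have "\<bar>f ((x(j := z))(i := y)) - f (x(i := y))\<bar> \<le> c j" if "y \<in> space (M i)" for y
    proof -
      have "j \<noteq> i" using j insert.hyps by auto
      then show ?thesis
        unfolding fun_upd_twist[OF \<open>j \<noteq> i\<close>]
        by (intro insert.prems(2) upd x that insertI2 j z)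
    qed
    then have "\<bar>\<integral>y. f ((x(j := z))(i := y)) - f (x(i := y)) \<partial>M i\<bar> \<le> (\<integral>y. c j \<partial>M i)"
      by (intro order.trans[OF integral_abs_bound] integral_mono
          Bochner_Integration.integrable_diff integrable_abs int x xz) auto
    then show ?thesis
      unfolding g_def using int[OF x] int[OF xz] by (simp add: M.prob_space)
  qed
  have "(\<integral>\<^sup>+x. ennreal (exp (l * (f x - \<mu>))) \<partial>PiM (insert i I) M) =
      (\<integral>\<^sup>+x. \<integral>\<^sup>+y. ennreal (exp (l * (f (x(i := y)) - \<mu>))) \<partial>M i \<partial>PiM I M)"
    by (rule product_nn_integral_insert[OF insert.hyps]) measurable
  also have "\<dots> \<le> (\<integral>\<^sup>+x. ennreal (exp (l\<^sup>2 * (c i)\<^sup>2 / 8)) * ennreal (exp (l * (g x - \<mu>))) \<partial>PiM I M)"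
  proof (rule nn_integral_mono)
    fix x assume x: "x \<in> space (PiM I M)"
    interpret S: interval_bounded_random_variable "M i" "\<lambda>y. f (x(i := y))"
      "INF y\<in>space (M i). f (x(i := y))" "(INF y\<in>space (M i). f (x(i := y))) + c i"
      by (rule slice[OF x])
    \<comment> \<open>The exponent is split at \<open>g x\<close>, the mean of the slice:
      Hoeffding's lemma handles the first factor, and the second is constant in
      \<open>y\<close>.\<close>
    have "(\<integral>\<^sup>+y. ennreal (exp (l * (f (x(i := y)) - \<mu>))) \<partial>M i) =
        (\<integral>\<^sup>+y. ennreal (exp (l * (f (x(i := y)) - g x))) * ennreal (exp (l * (g x - \<mu>))) \<partial>M i)"
      by (simp add: algebra_simps flip: ennreal_mult exp_add)
    also have "\<dots> = (\<integral>\<^sup>+y. ennreal (exp (l * (f (x(i := y)) - g x))) \<partial>M i)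
        * ennreal (exp (l * (g x - \<mu>)))"
      by (rule nn_integral_multc) measurable
    also have "\<dots> \<le> ennreal (exp (l\<^sup>2 * (c i)\<^sup>2 / 8)) * ennreal (exp (l * (g x - \<mu>)))"
      using S.Hoeffdings_lemma_nn_integral[OF l] by (intro mult_right_mono) (auto simp: g_def)
    finally show "(\<integral>\<^sup>+y. ennreal (exp (l * (f (x(i := y)) - \<mu>))) \<partial>M i) \<le>
        ennreal (exp (l\<^sup>2 * (c i)\<^sup>2 / 8)) * ennreal (exp (l * (g x - \<mu>)))" .
  qed
  also have "\<dots> = ennreal (exp (l\<^sup>2 * (c i)\<^sup>2 / 8)) * (\<integral>\<^sup>+x. ennreal (exp (l * (g x - \<mu>))) \<partial>PiM I M)"
    by (rule nn_integral_cmult) measurable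
  also have "\<dots> \<le> ennreal (exp (l\<^sup>2 * (c i)\<^sup>2 / 8)) * ennreal (exp (l\<^sup>2 * (\<Sum>j\<in>I. (c j)\<^sup>2) / 8))"
    using insert.IH[OF g diff_g] unfolding \<mu> by (intro mult_left_mono) auto
  also have "\<dots> = ennreal (exp (l\<^sup>2 * (\<Sum>j\<in>insert i I. (c j)\<^sup>2) / 8))"
    using insert.hyps by (simp add: field_simps flip: ennreal_mult exp_add)
  finally show ?case unfolding \<mu>_def .
qed

theorem McDiarmid_ge:
  assumes "finite I" and M: "\<And>i. prob_space (M i)" and f [measurable]: "f \<in> borel_measurable (PiM I M)"
    and diff: "\<And>x i y. x \<in> space (PiM I M) \<Longrightarrow> i \<in> I \<Longrightarrow> y \<in> space (M i) \<Longrightarrow>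
      \<bar>f (x(i := y)) - f x\<bar> \<le> (c i :: real)"
    and t: "0 \<le> t" and c: "0 < (\<Sum>i\<in>I. (c i)\<^sup>2)"
  shows "\<P>(x in PiM I M. integral\<^sup>L (PiM I M) f + t \<le> f x) \<le> exp (- 2 * t\<^sup>2 / (\<Sum>i\<in>I. (c i)\<^sup>2))"
proof (cases "t = 0")
  \<comment> \<open>The bound is 1 here. The case is separate because the optimal \<open>l\<close>
    below would be 0, while the moment bound requires \<open>0 < l\<close>.\<close>
  case True
  interpret P: prob_space "PiM I M"
    by (intro prob_space_PiM M)
  show ?thesis
    using True by simp
next
  case False
  define d where "d = (\<Sum>i\<in>I. (c i)\<^sup>2)"
  \<comment> \<open>Minimizer of the Chernoff exponent \<open>l\<^sup>2 * d / 8 - l * t\<close>,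
    whose minimum is \<open>- 2 * t\<^sup>2 / d\<close>.\<close>
  define l where "l = 4 * t / d"
  have l: "0 < l" and d: "0 < d"
    using False t c by (auto simp: l_def d_def)
  define \<mu> where "\<mu> = integral\<^sup>L (PiM I M) f"
  interpret P: prob_space "PiM I M"
    by (intro prob_space_PiM M)
  have "ennreal (\<P>(x in PiM I M. \<mu> + t \<le> f x)) = emeasure (PiM I M) {x \<in> space (PiM I M). t \<le> f x - \<mu>}"
    by (simp add: P.emeasure_eq_measure algebra_simps)
  also have "\<dots> \<le> ennreal (exp (- l * t)) * (\<integral>\<^sup>+x\<in>space (PiM I M). exp (l * (f x - \<mu>)) \<partial>PiM I M)"
    by (intro Chernoff_ineq_nn_integral_ge l) auto
  also have "(\<integral>\<^sup>+x\<in>space (PiM I M). exp (l * (f x - \<mu>)) \<partial>PiM I M) =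
      (\<integral>\<^sup>+x. ennreal (exp (l * (f x - \<mu>))) \<partial>PiM I M)"
    by (intro nn_integral_cong) simp
  also have "ennreal (exp (- l * t)) * \<dots> \<le> ennreal (exp (- l * t)) * ennreal (exp (l\<^sup>2 * d / 8))"
    unfolding \<mu>_def d_def
    by (intro mult_left_mono bounded_differences_exp_moment[OF \<open>finite I\<close> M f diff l]) auto
  also have "\<dots> = ennreal (exp (l\<^sup>2 * d / 8 - l * t))"
    by (simp add: algebra_simps flip: ennreal_mult exp_add)
  also have "l\<^sup>2 * d / 8 - l * t = - 2 * t\<^sup>2 / d"
    using d by (simp add: l_def field_simps power2_eq_square)
  finally show ?thesis
    by (simp add: \<mu>_def d_def)
qed

corollary McDiarmid_abs_ge:
  assumes "finite I" and M: "\<And>i. prob_space (M i)" and f [measurable]: "f \<in> borel_measurable (PiM I M)"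
    and diff: "\<And>x i y. x \<in> space (PiM I M) \<Longrightarrow> i \<in> I \<Longrightarrow> y \<in> space (M i) \<Longrightarrow>
      \<bar>f (x(i := y)) - f x\<bar> \<le> (c i :: real)"
    and t: "0 \<le> t" and c: "0 < (\<Sum>i\<in>I. (c i)\<^sup>2)"
  shows "\<P>(x in PiM I M. t \<le> \<bar>f x - integral\<^sup>L (PiM I M) f\<bar>) \<le>
    2 * exp (- 2 * t\<^sup>2 / (\<Sum>i\<in>I. (c i)\<^sup>2))"
proof -
  interpret P: prob_space "PiM I M"
    by (intro prob_space_PiM M)
  let ?m = "integral\<^sup>L (PiM I M) f"
  have "\<P>(x in PiM I M. t \<le> \<bar>f x - ?m\<bar>) \<le>
      P.prob ({x \<in> space (PiM I M). ?m + t \<le> f x} \<union> {x \<in> space (PiM I M). - ?m + t \<le> - f x})"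
    by (intro P.finite_measure_mono) auto
  also have "\<dots> \<le> \<P>(x in PiM I M. ?m + t \<le> f x) + \<P>(x in PiM I M. - ?m + t \<le> - f x)"
    by (intro measure_Un_le) measurable
  also have "\<P>(x in PiM I M. ?m + t \<le> f x) \<le> exp (- 2 * t\<^sup>2 / (\<Sum>i\<in>I. (c i)\<^sup>2))"
    by (rule McDiarmid_ge[OF \<open>finite I\<close> M f diff t c])
  also have "\<P>(x in PiM I M. - ?m + t \<le> - f x) \<le> exp (- 2 * t\<^sup>2 / (\<Sum>i\<in>I. (c i)\<^sup>2))"
    using McDiarmid_ge[OF \<open>finite I\<close> M, where f = "\<lambda>x. - f x" and c = c and t = t] diff t c
    by (simp add: abs_minus_commute)
  finally show ?thesis by simp
qed

text \<open>Hoeffding's bound for a binomial count, as the case of McDiarmid's inequality with all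
  constants 1. Since the mean is at most \<open>n * u\<close>, the threshold lies at least
  \<open>n * \<eta>\<close> above it.\<close>

lemma sum_indicator_ge_prob:
  fixes D :: "'a measure"
  assumes "prob_space D" and A [measurable]: "A \<in> sets D"
    and u: "measure D A \<le> u" and \<eta>: "0 \<le> \<eta>" and n: "0 < n"
  shows "\<P>(z in Pi\<^sub>M {..<n} (\<lambda>_. D). real n * (u + \<eta>) \<le> (\<Sum>i<n. indicator A (z i))) \<le>
    exp (- 2 * real n * \<eta>\<^sup>2)"
proof -
  let ?P = "Pi\<^sub>M {..<n} (\<lambda>_. D)"
  let ?f = "\<lambda>z. \<Sum>i<n. indicator A (z i) :: real"
  interpret D: prob_space D by fact
  interpret P: prob_space ?P by (intro prob_space_PiM assms)
  have diff: "\<bar>?f (z(i := y)) - ?f z\<bar> \<le> 1" if "i \<in> {..<n}" for z i y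
  proof -
    have "?f (z(i := y)) - ?f z = (\<Sum>j<n. if j = i then indicator A y - indicator A (z i) else 0)"
      unfolding sum_subtractf[symmetric] by (intro sum.cong) auto
    also have "\<dots> = indicator A y - indicator A (z i)"
      using that by simp
    finally show ?thesis by (auto simp: indicator_def)
  qed
  have comp: "(\<integral>z. indicator A (z i) \<partial>?P) = measure D A" if "i < n" for i
  proof -
    have "(\<integral>z. indicator A (z i) \<partial>?P) = (\<integral>x. indicat_real A x \<partial>distr ?P D (\<lambda>z. z i))"
      using that by (intro integral_distr[symmetric]) measurable
    also have "distr ?P D (\<lambda>z. z i) = D"
      using that by (intro distr_PiM_component[where M = "\<lambda>_. D"]) (auto intro: assms)
    finally show ?thesis by simp
  qed
  have "integral\<^sup>L ?P ?f = (\<Sum>i<n. \<integral>z. indicator A (z i) \<partial>?P)"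
    by (intro Bochner_Integration.integral_sum P.integrable_const_bound[where B = 1] AE_I2)
      (auto simp: indicator_def intro!: borel_measurable_if)
  then have mean: "integral\<^sup>L ?P ?f = real n * measure D A"
    using comp by simp
  have "\<P>(z in ?P. real n * (u + \<eta>) \<le> ?f z) \<le> \<P>(z in ?P. integral\<^sup>L ?P ?f + real n * \<eta> \<le> ?f z)"
  proof (rule P.finite_measure_mono)
    have "real n * measure D A + real n * \<eta> \<le> real n * (u + \<eta>)"
      unfolding distrib_left[symmetric] using u by (intro mult_left_mono) auto
    then show "{z \<in> space ?P. real n * (u + \<eta>) \<le> ?f z} \<subseteq>
        {z \<in> space ?P. integral\<^sup>L ?P ?f + real n * \<eta> \<le> ?f z}"
      unfolding mean by auto
  qed measurable
  also have "\<dots> \<le> exp (- 2 * (real n * \<eta>)\<^sup>2 / (\<Sum>i<n. 1\<^sup>2))"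
    by (rule McDiarmid_ge[where c = "\<lambda>_. 1"]) (use diff \<eta> n assms in auto)
  also have "- 2 * (real n * \<eta>)\<^sup>2 / (\<Sum>i<n. 1\<^sup>2) = - 2 * real n * \<eta>\<^sup>2"
    using n by (simp add: power2_eq_square)
  finally show ?thesis .
qed

section \<open>Distribution functions with bounded density\<close>

lemma has_density_increment:
  assumes F: "has_density F f" and L: "\<And>t. f t < L" and "a \<le> b"
  shows "F a \<le> F b" "F b - F a \<le> L * (b - a)"
proof -
  have f: "integrable lborel f" and nonneg: "\<And>t. 0 \<le> f t" and F: "\<And>t. F t = (LBINT u:{..t}. f u)"
    using F by (auto simp: has_density_def)
  have int: "set_integrable lborel A f" if "A \<in> sets borel" for A
    unfolding set_integrable_def using that f by (intro integrable_mult_indicator) auto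
  have "{..b} = {..a} \<union> {a<..b}" using \<open>a \<le> b\<close> by auto
  then have "F b = F a + (LBINT u:{a<..b}. f u)"
    unfolding F by (simp only:) (rule set_integral_Un[OF _ int int]; auto)
  moreover have "0 \<le> (LBINT u:{a<..b}. f u)"
    unfolding set_lebesgue_integral_def using nonneg by (intro integral_nonneg_AE) auto
  moreover have "set_integrable lborel {a<..b} (\<lambda>_. L)"
    unfolding set_integrable_def using \<open>a \<le> b\<close>
    by (intro integrable_scaleR_left) (simp add: integrable_indicator_iff)
  then have "(LBINT u:{a<..b}. f u) \<le> (LBINT u:{a<..b}. L)"
    using L by (intro set_integral_mono int) (auto intro: less_imp_le)
  moreover have "(LBINT u:{a<..b}. L) = L * (b - a)"
    using \<open>a \<le> b\<close> by (simp add: set_lebesgue_integral_def)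
  ultimately show "F a \<le> F b" "F b - F a \<le> L * (b - a)" by auto
qed

lemma has_density_continuous:
  assumes F: "has_density F f" and L: "\<And>t. f t < L"
  shows "continuous_on A F"
proof (rule lipschitz_on_continuous_on, rule lipschitz_onI)
  have "0 \<le> f 0" using F by (simp add: has_density_def)
  then show "0 \<le> L" using L[of 0] by linarith
  fix x y
  show "dist (F x) (F y) \<le> L * dist x y"
    using has_density_increment[OF assms, of x y] has_density_increment[OF assms, of y x]
    by (cases "x \<le> y") (auto simp: dist_real_def)
qed

lemma (in prob_space) continuous_cdf_attains:
  fixes R :: "'a \<Rightarrow> real"
  assumes R [measurable]: "R \<in> borel_measurable M"
    and cont: "continuous_on UNIV (\<lambda>t. \<P>(z in M. R z \<le> t))" and v: "0 < v" "v < 1"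
  obtains a where "\<P>(z in M. R z \<le> a) = v"
proof -
  define F where "F t = \<P>(z in M. R z \<le> t)" for t
  interpret R: real_distribution "distr M borel R"
    by (rule real_distribution_distr) measurable
  have F: "F = cdf (distr M borel R)"
    by (auto simp: F_def cdf_def measure_distr vimage_def Int_def conj_commute)
  have "eventually (\<lambda>t. v < F t) at_top"
    unfolding F by (rule order_tendstoD(1)[OF R.cdf_lim_at_top_prob v(2)])
  then obtain b where b: "\<And>t. b \<le> t \<Longrightarrow> v < F t" by (auto simp: eventually_at_top_linorder)
  have "eventually (\<lambda>t. F t < v) at_bot"
    unfolding F by (rule order_tendstoD(2)[OF R.cdf_lim_at_bot v(1)])
  then obtain a where a: "\<And>t. t \<le> a \<Longrightarrow> F t < v" by (auto simp: eventually_at_bot_linorder)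
  \<comment> \<open>The thresholds \<open>a\<close> and \<open>b\<close> come from separate limits
    and need not be ordered, hence the minimum and maximum.\<close>
  have "continuous_on {min a b..max a b} F"
    using cont unfolding F_def by (rule continuous_on_subset) auto
  then obtain x where "F x = v"
    using IVT'[of F "min a b" v "max a b"] a[of "min a b"] b[of "max a b"] by force
  then show ?thesis using that by (simp add: F_def)
qed

text \<open>Half of the probability integral transform. For a quantile \<open>a\<close> at level
  \<open>v\<close>, the event forces \<open>R w \<le> a\<close> by monotonicity, which has
  probability exactly \<open>v\<close>.\<close>

lemma (in prob_space) prob_cdf_less:
  fixes R :: "'a \<Rightarrow> real"
  assumes R [measurable]: "R \<in> borel_measurable M"
    and cont: "continuous_on UNIV (\<lambda>t. \<P>(z in M. R z \<le> t))" and v: "0 < v" "v < 1"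
  shows "\<P>(w in M. \<P>(z in M. R z \<le> R w) < v) \<le> v"
proof -
  obtain a where a: "\<P>(z in M. R z \<le> a) = v"
    using continuous_cdf_attains[OF assms] .
  have "R w \<le> a" if "\<P>(z in M. R z \<le> R w) < v" for w
  proof (rule ccontr)
    assume "\<not> R w \<le> a"
    then have "\<P>(z in M. R z \<le> a) \<le> \<P>(z in M. R z \<le> R w)"
      by (intro finite_measure_mono) auto
    with a that show False by simp
  qed
  then have "\<P>(w in M. \<P>(z in M. R z \<le> R w) < v) \<le> \<P>(w in M. R w \<le> a)"
    by (intro finite_measure_mono) auto
  with a show ?thesis by simp
qed

text \<open>The other half. For a quantile at level \<open>v\<close> itself the event would not
  exclude that \<open>R w\<close> equals it; at a level \<open>v' < v\<close> the event forces
  \<open>R w\<close> strictly above the quantile, giving \<open>1 - v'\<close>, and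
  \<open>v'\<close> tends to \<open>v\<close>. For levels \<open>v \<le> 0\<close>, which may occur
  in the application, the bound is at least 1.\<close>

lemma (in prob_space) prob_cdf_ge:
  fixes R :: "'a \<Rightarrow> real"
  assumes R [measurable]: "R \<in> borel_measurable M"
    and cont: "continuous_on UNIV (\<lambda>t. \<P>(z in M. R z \<le> t))" and v: "v < 1"
  shows "\<P>(w in M. v \<le> \<P>(z in M. R z \<le> R w)) \<le> 1 - v"
proof (cases "0 < v")
  case False
  then show ?thesis
    using prob_le_1[of "{w \<in> space M. v \<le> \<P>(z in M. R z \<le> R w)}"] by linarith
next
  case True
  have "v' \<le> 1 - \<P>(w in M. v \<le> \<P>(z in M. R z \<le> R w))" if v': "0 < v'" "v' < v" for v'
  proof -
    obtain a where a: "\<P>(z in M. R z \<le> a) = v'"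
      using continuous_cdf_attains[OF R cont, of v'] v' v by auto
    have "\<not> R w \<le> a" if "v \<le> \<P>(z in M. R z \<le> R w)" for w
    proof
      assume "R w \<le> a"
      then have "\<P>(z in M. R z \<le> R w) \<le> \<P>(z in M. R z \<le> a)"
        by (intro finite_measure_mono) auto
      with a that v' show False by simp
    qed
    then have "\<P>(w in M. v \<le> \<P>(z in M. R z \<le> R w)) \<le> \<P>(w in M. \<not> R w \<le> a)"
      by (intro finite_measure_mono) auto
    also have "\<dots> = 1 - \<P>(w in M. R w \<le> a)"
      by (rule prob_neg) measurable
    finally show ?thesis using a by simp
  qed
  from dense_le_bounded[OF True this] show ?thesis by simp
qed

section \<open>Empirical quantiles and counts of scores\<close>

lemma length_filter_mono:
  "(\<And>x. x \<in> set xs \<Longrightarrow> P x \<Longrightarrow> Q x) \<Longrightarrow> length (filter P xs) \<le> length (filter Q xs)"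
  by (induction xs) (auto simp: le_Suc_eq)

lemma length_filter_map_upt:
  "real (length (filter P (map g [0..<n]))) = (\<Sum>i<n. of_bool (P (g i)))"
  by (induction n) auto

text \<open>The quantile is the entry of rank \<open>k\<close>, with \<open>k\<close> the rounded-up
  value of \<open>q * length xs\<close>. The \<open>k\<close> smallest entries are at most the
  quantile, hence all below \<open>s\<close>.\<close>

lemma emp_quantile_less_imp:
  assumes less: "emp_quantile (mset xs) q < s" and "xs \<noteq> []" and q: "0 < q" "q \<le> 1"
  shows "q * real (length xs) \<le> real (length (filter (\<lambda>x. x < s) xs))"
proof -
  define k where "k = nat \<lceil>q * real (length xs)\<rceil>"
  \<comment> \<open>Positivity gives \<open>1 \<le> k\<close>, so that the index
    \<open>k - 1\<close> is not truncated at zero.\<close>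
  have "0 < q * real (length xs)" using assms by simp
  then have k: "0 < k" "q * real (length xs) \<le> real k"
    unfolding k_def by linarith+
  have "q * real (length xs) \<le> real (length xs)" using q by (simp add: mult_left_le_one_le)
  then have "k \<le> length xs" unfolding k_def by linarith
  have "sort xs ! (k - 1) < s"
    using less by (simp add: emp_quantile_def k_def sorted_list_of_multiset_mset)
  moreover have "sort xs ! i \<le> sort xs ! (k - 1)" if "i < k" for i
    using that k \<open>k \<le> length xs\<close> by (intro sorted_nth_mono) auto
  ultimately have "{..<k} \<subseteq> {i. i < length (sort xs) \<and> sort xs ! i < s}"
    using \<open>k \<le> length xs\<close> by (fastforce intro: le_less_trans)
  then have "card {..<k} \<le> length (filter (\<lambda>x. x < s) (sort xs))"
    unfolding length_filter_conv_card by (intro card_mono) auto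
  also have "length (filter (\<lambda>x. x < s) (sort xs)) = length (filter (\<lambda>x. x < s) xs)"
    by (metis mset_filter mset_sort size_mset)
  finally show ?thesis using k by simp
qed

text \<open>Miscoverage means that the score of the test point strictly exceeds the quantile of all
  scores. Passing from the augmented fit to the fixed predictor \<open>m\<close> moves each of the
  two compared scores by at most \<open>\<Delta> / 2\<close>, hence the slack
  \<open>\<Delta>\<close>.\<close>

lemma miscovered_imp_count:
  assumes notin: "y \<notin> full_conformal Y T mu \<alpha> zs x" and "y \<in> Y" and \<alpha>: "0 \<le> \<alpha>" "\<alpha> < 1"
    and near: "\<And>z. z \<in> insert (x, y) (set zs) \<Longrightarrow> \<bar>mu (T (zs @ [(x, y)])) (fst z) - m (fst z)\<bar> \<le> \<Delta> / 2"
  shows "(1 - \<alpha>) * (real (length zs) + 1) \<le>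
    real (length (filter (\<lambda>z. \<bar>snd z - m (fst z)\<bar> < \<bar>y - m x\<bar> + \<Delta>) zs))"
proof -
  define s where "s = (\<lambda>z. \<bar>snd z - mu (T (zs @ [(x, y)])) (fst z)\<bar>)"
  have scores: "conformal_scores T mu zs x y = mset (map s (zs @ [(x, y)]))"
    by (simp add: conformal_scores_def s_def case_prod_unfold)
  have "emp_quantile (mset (map s (zs @ [(x, y)]))) (1 - \<alpha>) < s (x, y)"
    unfolding scores[symmetric] using notin \<open>y \<in> Y\<close> by (simp add: full_conformal_def s_def)
  \<comment> \<open>The test point is not strictly below its own score, so every entry counted lies
    in \<open>zs\<close>, although the rank refers to \<open>length zs + 1\<close> scores.\<close>
  from emp_quantile_less_imp[OF this] \<alpha>
  have "(1 - \<alpha>) * (real (length zs) + 1) \<le> real (length (filter (\<lambda>z. s z < s (x, y)) zs))"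
    by (simp add: filter_map comp_def add.commute)
  also have "length (filter (\<lambda>z. s z < s (x, y)) zs) \<le>
      length (filter (\<lambda>z. \<bar>snd z - m (fst z)\<bar> < \<bar>y - m x\<bar> + \<Delta>) zs)"
  proof (rule length_filter_mono)
    fix z assume z: "z \<in> set zs" and less: "s z < s (x, y)"
    have "\<bar>mu (T (zs @ [(x, y)])) (fst z) - m (fst z)\<bar> \<le> \<Delta> / 2"
      "\<bar>mu (T (zs @ [(x, y)])) x - m x\<bar> \<le> \<Delta> / 2"
      using near[of z] near[of "(x, y)"] z by auto
    with less show "\<bar>snd z - m (fst z)\<bar> < \<bar>y - m x\<bar> + \<Delta>"
      unfolding s_def fst_conv snd_conv by linarith
  qed
  finally show ?thesis by simp
qed

section \<open>Supremum norms and deletion from lists\<close>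

lemma abs_diff_le_sup_norm_on:
  assumes "bounded (f ` A)" "bounded (g ` A)" "x \<in> A"
  shows "\<bar>f x - g x\<bar> \<le> sup_norm_on A (\<lambda>x. f x - g x)"
proof -
  obtain a b where "\<And>x. x \<in> A \<Longrightarrow> \<bar>f x\<bar> \<le> a" "\<And>x. x \<in> A \<Longrightarrow> \<bar>g x\<bar> \<le> b"
    using assms unfolding bounded_real by blast
  then have "bdd_above ((\<lambda>x. \<bar>f x - g x\<bar>) ` A)"
    by (intro bdd_aboveI2[where M = "a + b"]) fastforce
  then show ?thesis
    unfolding sup_norm_on_def using \<open>x \<in> A\<close> by (rule cSUP_upper2) simp
qed

lemma sup_norm_on_le:
  assumes "A \<noteq> {}" "\<And>x. x \<in> A \<Longrightarrow> \<bar>f x\<bar> \<le> K"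
  shows "sup_norm_on A f \<le> K"
  unfolding sup_norm_on_def using assms by (rule cSUP_least)

lemma delete_nth_list_update: "delete_nth i (zs[i := z]) = delete_nth i zs"
  by (simp add: delete_nth_def)

lemma delete_nth_snoc: "delete_nth (length zs) (zs @ [z]) = zs"
  by (simp add: delete_nth_def)

lemma infnorm_le_cart:
  fixes v :: "real ^ 'n"
  assumes "\<And>j. \<bar>v $ j\<bar> \<le> t"
  shows "infnorm v \<le> t"
  using assms unfolding infnorm_Max by (auto simp: Basis_vec_def inner_axis)

section \<open>Conditional probabilities of events\<close>

text \<open>Let \<open>B\<close> be the part of \<open>G\<close> where the conditional probability
  exceeds \<open>r\<close>. Its integral over \<open>B\<close> is
  \<open>prob (B \<inter> E)\<close>, at most
  \<open>prob (B \<inter> C) = prob B * prob C \<le> prob B * r\<close>, yet the integrand exceeds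
  \<open>r\<close> on \<open>B\<close>; so \<open>B\<close> is null. This avoids any explicit
  formula for the conditional probability given the data.\<close>

lemma (in prob_space) prob_real_cond_exp_indicator_gt:
  assumes sub: "subalgebra M F" and E: "E \<in> events" and G: "G \<in> sets F" and C: "C \<in> events"
    and "E \<inter> G \<subseteq> C" and indep: "\<And>A. A \<in> sets F \<Longrightarrow> prob (A \<inter> C) = prob A * prob C"
    and "prob C \<le> r"
  shows "\<P>(w in M. r < real_cond_exp M F (indicat_real E) w) \<le> prob (space M - G)"
proof -
  interpret finite_measure_subalgebra M F by standard (rule sub)
  let ?e = "real_cond_exp M F (indicat_real E)"
  have space: "space F = space M" and sets: "sets F \<subseteq> events"
    using sub by (auto simp: subalgebra_def)
  define B where "B = {w \<in> space F. r < ?e w} \<inter> G"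
  have BF: "B \<in> sets F"
    unfolding B_def using G by measurable
  have [measurable]: "B \<in> events" "E \<in> events"
    using BF sets E by auto
  have int_E: "integrable M (indicat_real E)"
    by (simp add: integrable_indicator_iff less_top[symmetric])
  have int_e: "integrable M (\<lambda>w. indicator B w * ?e w)"
    using integrable_mult_indicator[OF \<open>B \<in> events\<close> real_cond_exp_int(1)[OF int_E]] by simp
  have int_r: "integrable M (\<lambda>w. indicator B w * r)"
    by (intro integrable_mult_left) (simp add: integrable_indicator_iff less_top[symmetric])
  have "(\<integral>w. indicator B w * ?e w \<partial>M) = (\<integral>w. indicator B w * indicat_real E w \<partial>M)"
    using real_cond_exp_intA[OF int_E BF] by (simp add: set_lebesgue_integral_def)
  also have "\<dots> = prob (B \<inter> E)"
    by (simp add: indicator_inter_arith[symmetric])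
  also have "\<dots> \<le> prob (B \<inter> C)"
  proof (rule finite_measure_mono)
    show "B \<inter> E \<subseteq> B \<inter> C" using \<open>E \<inter> G \<subseteq> C\<close> by (auto simp: B_def)
    show "B \<inter> C \<in> events" using C by simp
  qed
  also have "\<dots> = prob B * prob C"
    by (rule indep[OF BF])
  also have "\<dots> \<le> prob B * r"
    by (intro mult_left_mono) (use \<open>prob C \<le> r\<close> in auto)
  finally have "(\<integral>w. indicator B w * ?e w - indicator B w * r \<partial>M) \<le> 0"
    using int_e int_r by simp
  moreover have nonneg: "0 \<le> indicator B w * ?e w - indicator B w * r" for w
    by (auto simp: indicator_def B_def)
  ultimately have "(\<integral>w. indicator B w * ?e w - indicator B w * r \<partial>M) = 0"
    by (intro antisym integral_nonneg_AE) auto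
  then have "AE w in M. indicator B w * ?e w - indicator B w * r = 0"
    using integral_nonneg_eq_0_iff_AE[OF Bochner_Integration.integrable_diff[OF int_e int_r]] nonneg
    by simp
  then have "AE w in M. w \<notin> B"
    by eventually_elim (auto simp: B_def indicator_def)
  then have "prob B = 0"
    using prob_eq_0[of B] by simp
  have "\<P>(w in M. r < ?e w) \<le> prob (B \<union> (space M - G))"
    using G sets by (intro finite_measure_mono) (auto simp: B_def space)
  also have "\<dots> \<le> prob B + prob (space M - G)"
    using G sets by (intro measure_Un_le) auto
  finally show ?thesis using \<open>prob B = 0\<close> by simp
qed

text \<open>
  Spares the main proof the joint measurability of \<open>(\<beta>, x) \<mapsto> mu \<beta> x\<close>, which would be needed to see
  that the miscoverage event is measurable: otherwise its conditional probability is a junk value,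
  but a nonpositive one.
\<close>

lemma real_cond_exp_indicator_nonmeasurable:
  assumes "E \<subseteq> space M" "E \<notin> sets M"
  shows "real_cond_exp M F (indicat_real E) w \<le> 0"
proof -
  have "(\<lambda>x. ennreal (indicat_real E x)) \<notin> borel_measurable M"
  proof
    assume "(\<lambda>x. ennreal (indicat_real E x)) \<in> borel_measurable M"
    then have "{x \<in> space M. 0 < ennreal (indicat_real E x)} \<in> sets M" by measurable
    also have "{x \<in> space M. 0 < ennreal (indicat_real E x)} = E"
      using assms(1) by (auto simp: indicator_def split: if_splits)
    finally show False using assms(2) by simp
  qed
  then have "nn_cond_exp M F (\<lambda>x. ennreal (indicat_real E x)) = (\<lambda>_. 0)"
    by (simp add: nn_cond_exp_def)
  then show ?thesis by (simp add: real_cond_exp_def)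
qed

section \<open>Stability and concentration of the fitted parameter\<close>

text \<open>Both fits are compared with the fit on the list without entry \<open>i\<close>, which is
  the same for both: \<open>c / 2\<close> twice gives \<open>c\<close> for the predictors, and the
  lower Lipschitz bound carries this to the parameters.\<close>

lemma stable_param_difference:
  fixes T :: "('x \<times> real) list \<Rightarrow> real ^ 'p" and mu :: "real ^ 'p \<Rightarrow> 'x \<Rightarrow> real"
  assumes "A \<noteq> {}" and bdd: "\<And>\<beta>. bounded (mu \<beta> ` A)"
    and stable: "\<And>zs i. length zs = k \<Longrightarrow> set zs \<subseteq> A \<times> Y \<Longrightarrow> i < k \<Longrightarrow>
      sup_norm_on A (\<lambda>x. mu (T (delete_nth i zs)) x - mu (T zs) x) \<le> c / 2"
    and "0 < \<kappa>"
    and inverse_lipschitz: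
      "\<And>\<beta> \<beta>'. \<kappa> * infnorm (\<beta> - \<beta>') \<le> sup_norm_on A (\<lambda>x. mu \<beta> x - mu \<beta>' x)"
    and zs: "length zs = k" "set zs \<subseteq> A \<times> Y" and z: "z \<in> A \<times> Y" and i: "i < k"
  shows "\<bar>T (zs[i := z]) $ j - T zs $ j\<bar> \<le> c / \<kappa>"
proof -
  let ?zs = "zs[i := z]"
  have zs': "length ?zs = k" "set ?zs \<subseteq> A \<times> Y"
    using zs z set_update_subset_insert[of zs i z] by auto
  have "sup_norm_on A (\<lambda>x. mu (T ?zs) x - mu (T zs) x) \<le> c"
  proof (rule sup_norm_on_le[OF \<open>A \<noteq> {}\<close>])
    fix x assume x: "x \<in> A"
    have "\<bar>mu (T (delete_nth i zs)) x - mu (T ws) x\<bar> \<le> c / 2"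
      if "length ws = k" "set ws \<subseteq> A \<times> Y" "delete_nth i ws = delete_nth i zs" for ws
      using abs_diff_le_sup_norm_on[OF bdd bdd x] stable[OF that(1,2) i] that(3) by (metis order.trans)
    from this[OF zs refl] this[OF zs' delete_nth_list_update]
    show "\<bar>mu (T ?zs) x - mu (T zs) x\<bar> \<le> c" by linarith
  qed
  then have "\<kappa> * infnorm (T ?zs - T zs) \<le> c"
    using inverse_lipschitz order.trans by blast
  then have "infnorm (T ?zs - T zs) \<le> c / \<kappa>"
    using \<open>0 < \<kappa>\<close> by (simp add: field_simps)
  then show ?thesis
    using component_le_infnorm_cart[of "T ?zs - T zs" j] by simp
qed

lemma map_fun_upd_upt: "i < n \<Longrightarrow> map (z(i := y)) [0..<n] = (map z [0..<n])[i := y]"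
  by (rule nth_equalityI) (auto simp: nth_list_update)

text \<open>McDiarmid's inequality is applied to each coordinate; the factor 2 accounts for the two
  tails and \<open>CARD('p)\<close> for the union bound.\<close>

lemma mean_param_concentration:
  fixes T :: "('x \<times> real) list \<Rightarrow> real ^ 'p"
  assumes "prob_space D"
    and meas [measurable]:
      "\<And>j. (\<lambda>z. T (map z [0..<n]) $ j) \<in> borel_measurable (Pi\<^sub>M {..<n} (\<lambda>_. D))"
    and diff: "\<And>z i y j. z \<in> space (Pi\<^sub>M {..<n} (\<lambda>_. D)) \<Longrightarrow> i < n \<Longrightarrow> y \<in> space D \<Longrightarrow>
      \<bar>T ((map z [0..<n])[i := y]) $ j - T (map z [0..<n]) $ j\<bar> \<le> b"
    and "0 < b" "0 < n" "0 \<le> t"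
  shows "\<P>(z in Pi\<^sub>M {..<n} (\<lambda>_. D). \<exists>j. t \<le> \<bar>T (map z [0..<n]) $ j - mean_param D T n $ j\<bar>) \<le>
    2 * real CARD('p) * exp (- 2 * t\<^sup>2 / (real n * b\<^sup>2))"
proof -
  let ?P = "Pi\<^sub>M {..<n} (\<lambda>_. D)"
  let ?f = "\<lambda>j z. T (map z [0..<n]) $ j"
  have "\<P>(z in ?P. t \<le> \<bar>?f j z - mean_param D T n $ j\<bar>) \<le>
      2 * exp (- 2 * t\<^sup>2 / (real n * b\<^sup>2))" for j
  proof -
    have "\<P>(z in ?P. t \<le> \<bar>?f j z - integral\<^sup>L ?P (?f j)\<bar>) \<le> 2 * exp (- 2 * t\<^sup>2 / (\<Sum>i<n. b\<^sup>2))"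
      using assms(1) diff \<open>0 \<le> t\<close> \<open>0 < b\<close> \<open>0 < n\<close>
      by (intro McDiarmid_abs_ge[where c = "\<lambda>_. b"]) (auto simp: map_fun_upd_upt simp del: fun_upd_apply)
    then show ?thesis by (simp add: mean_param_def)
  qed
  then have "(\<Sum>j\<in>UNIV. \<P>(z in ?P. t \<le> \<bar>?f j z - mean_param D T n $ j\<bar>)) \<le>
      (\<Sum>j\<in>(UNIV :: 'p set). 2 * exp (- 2 * t\<^sup>2 / (real n * b\<^sup>2)))"
    by (rule sum_mono)
  moreover have "{z \<in> space ?P. \<exists>j. t \<le> \<bar>?f j z - mean_param D T n $ j\<bar>} =
      (\<Union>j\<in>UNIV. {z \<in> space ?P. t \<le> \<bar>?f j z - mean_param D T n $ j\<bar>})"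
    by auto
  moreover have "measure ?P (\<Union>j\<in>UNIV. {z \<in> space ?P. t \<le> \<bar>?f j z - mean_param D T n $ j\<bar>}) \<le>
      (\<Sum>j\<in>UNIV. \<P>(z in ?P. t \<le> \<bar>?f j z - mean_param D T n $ j\<bar>))"
    by (intro measure_UNION_le) auto
  ultimately show ?thesis by simp
qed

section \<open>Training-conditional coverage of the full-conformal region\<close>

theorem theorem2:
  fixes M :: "'w measure" and MX :: "'x measure" and Y :: "real set"
    and D :: "('x \<times> real) measure"
    and Z :: "nat \<Rightarrow> 'w \<Rightarrow> 'x \<times> real" and Ztest :: "'w \<Rightarrow> 'x \<times> real"
    and T :: "('x \<times> real) list \<Rightarrow> real ^ 'p" and mu :: "real ^ 'p \<Rightarrow> 'x \<Rightarrow> real"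
    and c L :: "nat \<Rightarrow> real" and \<kappa>\<^sub>1 \<kappa>\<^sub>2 \<alpha> \<epsilon> \<delta> :: real and n :: nat
  assumes "Y \<in> sets borel"
    and "\<And>\<beta>. mu \<beta> \<in> borel_measurable MX"
    and "\<And>\<beta>. bounded (mu \<beta> ` space MX)"
    and "training_algorithm (obs_space MX Y) T"
    and "\<And>k. 2 \<le> k \<Longrightarrow> 0 < c k"
    and "2 \<le> n" and "0 < \<alpha>" and "\<alpha> < 1"
    and "prob_space M"
    and iid: "prob_space.indep_vars M (\<lambda>_. obs_space MX Y) (Z(n := Ztest)) {..n}"
      "\<And>i. i < n \<Longrightarrow> distr M (obs_space MX Y) (Z i) = D"
      "distr M (obs_space MX Y) Ztest = D"
    and A1: "\<And>k zs i. 2 \<le> k \<Longrightarrow> length zs = k \<Longrightarrow> set zs \<subseteq> space MX \<times> Y \<Longrightarrow> i < k \<Longrightarrow>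
        sup_norm_on (space MX) (\<lambda>x. mu (T (delete_nth i zs)) x - mu (T zs) x) \<le> c k / 2"
    and A2: "0 < \<kappa>\<^sub>1"
      "\<And>\<beta> \<beta>'. \<kappa>\<^sub>1 * infnorm (\<beta> - \<beta>') \<le> sup_norm_on (space MX) (\<lambda>x. mu \<beta> x - mu \<beta>' x)"
      "\<And>\<beta> \<beta>'. sup_norm_on (space MX) (\<lambda>x. mu \<beta> x - mu \<beta>' x) \<le> \<kappa>\<^sub>2 * infnorm (\<beta> - \<beta>')"
    and A3: "\<And>k. 1 \<le> k \<Longrightarrow> \<exists>f. has_density (resid_cdf D (mu (mean_param D T k))) f \<and> (\<forall>t. f t < L k)"
    and "0 < \<epsilon>" and "0 < \<delta>"
  shows "\<P>(w in M. miscoverage M MX Y T mu \<alpha> n Z Ztest w >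
           \<alpha> + sqrt (ln (2 / \<delta>) / (2 * real n))
             + L n * (c (n + 1)
                 + sqrt (2 * real n * ln (2 * real CARD('p) / \<epsilon>)) * (\<kappa>\<^sub>2 * c n / \<kappa>\<^sub>1)))
         \<le> \<epsilon> + \<delta>"
proof (cases "\<epsilon> < 1 \<and> \<delta> < 1")
  \<comment> \<open>Now \<open>1 \<le> \<epsilon> + \<delta>\<close> and the claim is trivial,
    whatever value \<open>sqrt\<close> takes at a negative argument. In the other case both
    logarithms are positive.\<close>
  case False
  then show ?thesis
    using prob_space.prob_le_1[OF \<open>prob_space M\<close>] \<open>0 < \<epsilon>\<close> \<open>0 < \<delta>\<close>
    by (smt (verit, best))
next
  case True
  let ?S = "obs_space MX Y"
  let ?P = "Pi\<^sub>M {..<n} (\<lambda>_. D)"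
  interpret prob_space M by fact
  note [measurable] = assms(2)

  define \<eta> where "\<eta> = sqrt (ln (2 / \<delta>) / (2 * real n))"
  define r where "r = sqrt (2 * real n * ln (2 * real CARD('p) / \<epsilon>))"
  define \<Delta> where "\<Delta> = c (n + 1) + r * (\<kappa>\<^sub>2 * c n / \<kappa>\<^sub>1)"
  define thr where "thr = \<alpha> + \<eta> + L n * \<Delta>"
  \<comment> \<open>At this deviation of the parameter the union bound over the coordinates equals
    \<open>\<epsilon>\<close>. Moreover
    \<open>\<Delta> / 2 = \<kappa>\<^sub>2 * t + c (n + 1) / 2\<close>, which will bound the
    distance between the augmented predictor and \<open>m\<close>.\<close>
  define t where "t = r / 2 * (c n / \<kappa>\<^sub>1)"
  define \<beta>\<^sub>0 where "\<beta>\<^sub>0 = mean_param D T n"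
  define m where "m = mu \<beta>\<^sub>0"
  define R where "R = (\<lambda>z. \<bar>snd z - m (fst z)\<bar>)"
  define F where "F = resid_cdf D m"
  define u where "u = 1 - \<alpha> - \<eta>"
  define A where "A = {z \<in> space D. F (R z) < u}"

  have n: "0 < n" using \<open>2 \<le> n\<close> by simp
  have c: "0 < c n" "0 < c (n + 1)" using assms(5)[of n] assms(5)[of "n + 1"] \<open>2 \<le> n\<close> by auto
  have card_p: "1 \<le> real CARD('p)" by (simp add: Suc_leI)
  have "\<epsilon> < 2 * real CARD('p)" using card_p True by linarith
  then have "1 < 2 * real CARD('p) / \<epsilon>" using \<open>0 < \<epsilon>\<close> by simp
  then have ln_p: "0 < ln (2 * real CARD('p) / \<epsilon>)" by (rule ln_gt_zero)
  have "1 < 2 / \<delta>" using True \<open>0 < \<delta>\<close> by (simp add: field_simps)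
  then have ln_d: "0 < ln (2 / \<delta>)" by (rule ln_gt_zero)
  have r: "0 < r" "r\<^sup>2 = 2 * real n * ln (2 * real CARD('p) / \<epsilon>)"
    using ln_p n by (auto simp: r_def)
  have \<eta>: "0 < \<eta>" "\<eta>\<^sup>2 = ln (2 / \<delta>) / (2 * real n)"
    using ln_d n by (auto simp: \<eta>_def)
  have t: "0 < t" using r c A2(1) by (simp add: t_def)
  \<comment> \<open>The zero and all-ones parameters differ, so the two Lipschitz bounds force
    \<open>\<kappa>\<^sub>1 \<le> \<kappa>\<^sub>2\<close>.\<close>
  have "0 \<le> \<kappa>\<^sub>2"
  proof -
    have "0 < infnorm (1 - 0 :: real ^ 'p)" by (simp add: infnorm_pos_lt)
    moreover have "\<kappa>\<^sub>1 * infnorm (1 - 0 :: real ^ 'p) \<le> \<kappa>\<^sub>2 * infnorm (1 - 0 :: real ^ 'p)"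
      using A2(2,3) order.trans by blast
    ultimately show ?thesis using A2(1) by simp
  qed
  have \<Delta>: "0 < \<Delta>" using r c A2(1) \<open>0 \<le> \<kappa>\<^sub>2\<close> by (simp add: \<Delta>_def add_pos_nonneg)
  obtain f where f: "has_density F f" "\<And>t. f t < L n"
    using A3[of n] n by (auto simp: F_def m_def \<beta>\<^sub>0_def)
  have "0 < L n"
    using f(2)[of 0] f(1) by (auto simp: has_density_def intro: le_less_trans)
  \<comment> \<open>Positivity of the threshold settles the case of a nonmeasurable miscoverage
    event, where the conditional probability is nonpositive.\<close>
  then have thr: "0 < thr" using \<Delta> \<eta> \<open>0 < \<alpha>\<close> by (simp add: thr_def add_pos_pos)

  \<comment> \<open>Law of the training data\<close>
  have rv: "random_variable ?S ((Z(n := Ztest)) i)" if "i \<le> n" for i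
    using iid(1) that by (simp add: indep_vars_def)
  have rv_test [measurable]: "random_variable ?S Ztest"
    using rv[of n] by simp
  have sets_D [measurable_cong]: "sets D = sets ?S"
    unfolding iid(3)[symmetric] by simp
  have space_S: "space ?S = space MX \<times> Y"
    by (simp add: obs_space_def space_pair_measure space_restrict_space)
  have space_D: "space D = space MX \<times> Y"
    using sets_eq_imp_space_eq[OF sets_D] space_S by simp
  interpret D: prob_space D
    unfolding iid(3)[symmetric] by (rule prob_space_distr) (rule rv_test)
  interpret P: prob_space ?P
    by (intro prob_space_PiM D.prob_space_axioms)
  have MX_ne: "space MX \<noteq> {}" using D.not_empty space_D by auto
  have sets_P: "sets ?P = sets (Pi\<^sub>M {..<n} (\<lambda>_. ?S))"
    by (intro sets_PiM_cong sets_D refl)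
  have space_P: "space ?P = space (Pi\<^sub>M {..<n} (\<lambda>_. ?S))"
    by (rule sets_eq_imp_space_eq[OF sets_P])

  \<comment> \<open>In the family \<open>Z(n := Ztest)\<close> the test point has index
    \<open>n\<close>, so the training data are its restriction to the indices below
    \<open>n\<close>.\<close>
  have data_vec: "data_vec n Z = (\<lambda>w. \<lambda>i\<in>{..<n}. (Z(n := Ztest)) i w)"
    by (auto simp: data_vec_def fun_eq_iff restrict_def)
  have rv_data: "random_variable (Pi\<^sub>M {..<n} (\<lambda>_. ?S)) (data_vec n Z)"
    unfolding data_vec by (intro measurable_restrict rv) auto
  have "indep_vars (\<lambda>_. ?S) (Z(n := Ztest)) {..<n}"
    using iid(1) by (rule indep_vars_subset) auto
  then have "distr M (Pi\<^sub>M {..<n} (\<lambda>_. ?S)) (data_vec n Z) =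
      Pi\<^sub>M {..<n} (\<lambda>i. distr M ?S ((Z(n := Ztest)) i))"
    unfolding data_vec
  proof (rule iffD1[OF indep_vars_iff_distr_eq_PiM', rotated 2])
    show "{..<n} \<noteq> {}" using n by auto
    show "random_variable ?S ((Z(n := Ztest)) i)" if "i \<in> {..<n}" for i
      using that by (intro rv) simp
  qed
  also have "\<dots> = ?P"
    using iid(2) by (intro PiM_cong) auto
  finally have distr_data: "distr M (Pi\<^sub>M {..<n} (\<lambda>_. ?S)) (data_vec n Z) = ?P" .
  have prob_data: "prob (data_vec n Z -` B \<inter> space M) = P.prob B" if "B \<in> sets ?P" for B
    using measure_distr[OF rv_data, of B] that unfolding distr_data sets_P by simp
  have data_list: "data_list n Z w = map (data_vec n Z w) [0..<n]" for w
    by (auto simp: data_list_def data_vec_def)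
  have set_data: "set (map z [0..<n]) \<subseteq> space MX \<times> Y" if "z \<in> space ?P" for z
    using that space_D by (auto simp: space_PiM PiE_def Pi_def)

  \<comment> \<open>Residuals of the fixed predictor\<close>
  have R [measurable]: "R \<in> borel_measurable D"
  proof -
    have "snd \<in> borel_measurable ?S"
      unfolding obs_space_def
      using measurable_compose[OF measurable_snd measurable_restrict_space1[OF measurable_ident]] by simp
    moreover have "(\<lambda>z. m (fst z)) \<in> borel_measurable ?S"
      unfolding obs_space_def m_def by measurable
    ultimately have "R \<in> borel_measurable ?S"
      unfolding R_def by measurable
    then show ?thesis by measurable
  qed
  have F: "F = (\<lambda>t. D.prob {z \<in> space D. R z \<le> t})"
    by (simp add: F_def resid_cdf_def R_def fun_eq_iff)
  have F_mono: "mono F"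
    using has_density_increment(1)[OF f] by (simp add: monoI)
  have [measurable]: "F \<in> borel_measurable borel"
    by (rule borel_measurable_mono[OF F_mono])
  have F_cont: "continuous_on UNIV (\<lambda>t. D.prob {z \<in> space D. R z \<le> t})"
    using has_density_continuous[OF f] by (simp add: F)
  have A [measurable]: "A \<in> sets D"
    unfolding A_def by measurable

  \<comment> \<open>The good event for the training data\<close>
  have T_meas: "(\<lambda>z. T (map z [0..<n])) \<in> borel_measurable ?P"
    using assms(4) n by (simp add: training_algorithm_def measurable_cong_sets[OF sets_P refl])
  have [measurable]: "(\<lambda>z. T (map z [0..<n]) $ j) \<in> borel_measurable ?P" for j
    using measurable_compose[OF T_meas borel_measurable_continuous_onI[of "\<lambda>v. v $ j"]]
    by (simp add: continuous_on_component)

  \<comment> \<open>Avoiding the first set puts the fit near the mean parameter; avoiding the second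
    contradicts the count that miscoverage would force if
    \<open>F (R (x, y) + \<Delta>) < u\<close>.\<close>
  define G\<^sub>0 where "G\<^sub>0 = space ?P -
    ({z \<in> space ?P. \<exists>j. t \<le> \<bar>T (map z [0..<n]) $ j - \<beta>\<^sub>0 $ j\<bar>} \<union>
     {z \<in> space ?P. real n * (1 - \<alpha>) \<le> (\<Sum>i<n. indicator A (z i))})"
  have G\<^sub>0 [measurable]: "G\<^sub>0 \<in> sets ?P"
    unfolding G\<^sub>0_def by measurable
  have "P.prob {z \<in> space ?P. \<exists>j. t \<le> \<bar>T (map z [0..<n]) $ j - \<beta>\<^sub>0 $ j\<bar>} \<le>
      2 * real CARD('p) * exp (- 2 * t\<^sup>2 / (real n * (c n / \<kappa>\<^sub>1)\<^sup>2))"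
    unfolding \<beta>\<^sub>0_def
  proof (rule mean_param_concentration)
    show "\<bar>T ((map z [0..<n])[i := y]) $ j - T (map z [0..<n]) $ j\<bar> \<le> c n / \<kappa>\<^sub>1"
      if "z \<in> space ?P" "i < n" "y \<in> space D" for z i y j
      using stable_param_difference[OF MX_ne assms(3) A1[OF \<open>2 \<le> n\<close>] A2(1,2) _ set_data[OF that(1)]]
        that space_D by simp
  qed (use t c A2(1) n D.prob_space_axioms in auto)
  \<comment> \<open>Here the choice of \<open>t\<close> enters:
    \<open>c n / \<kappa>\<^sub>1\<close> cancels and \<open>r\<^sup>2\<close> supplies the
    logarithm.\<close>
  also have "- 2 * t\<^sup>2 / (real n * (c n / \<kappa>\<^sub>1)\<^sup>2) = - ln (2 * real CARD('p) / \<epsilon>)"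
  proof -
    have "t\<^sup>2 = real n * ln (2 * real CARD('p) / \<epsilon>) / 2 * (c n / \<kappa>\<^sub>1)\<^sup>2"
      unfolding t_def power_mult_distrib power_divide r by (simp add: power2_eq_square)
    moreover have "real n * (c n / \<kappa>\<^sub>1)\<^sup>2 \<noteq> 0" using n c A2(1) by simp
    ultimately show ?thesis by (simp only: nonzero_divide_eq_eq) simp
  qed
  also have "2 * real CARD('p) * exp (- ln (2 * real CARD('p) / \<epsilon>)) = \<epsilon>"
    using \<open>0 < \<epsilon>\<close> card_p by (simp add: exp_minus)
  finally have bad_param: "P.prob {z \<in> space ?P. \<exists>j. t \<le> \<bar>T (map z [0..<n]) $ j - \<beta>\<^sub>0 $ j\<bar>} \<le> \<epsilon>" .
  \<comment> \<open>Since \<open>u + \<eta> = 1 - \<alpha>\<close>, the count threshold is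
    \<open>n * (u + \<eta>)\<close>, while \<open>A\<close> has probability at most \<open>u\<close>
    if \<open>0 < u\<close>. Only one tail is bounded, so the estimate obtained is in fact
    \<open>\<delta> / 2\<close>.\<close>
  have bad_count: "P.prob {z \<in> space ?P. real n * (1 - \<alpha>) \<le> (\<Sum>i<n. indicator A (z i))} \<le> \<delta>"
  proof (cases "0 < u")
    case True
    have "u < 1" using \<eta> \<open>0 < \<alpha>\<close> by (simp add: u_def)
    then have "D.prob A \<le> u"
      using D.prob_cdf_less[OF R F_cont True] by (simp add: A_def F)
    from sum_indicator_ge_prob[OF D.prob_space_axioms A this, of \<eta> n]
    have "P.prob {z \<in> space ?P. real n * (1 - \<alpha>) \<le> (\<Sum>i<n. indicator A (z i))} \<le>
        exp (- 2 * real n * \<eta>\<^sup>2)"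
      using \<eta> n by (simp add: u_def)
    also have "- 2 * real n * \<eta>\<^sup>2 = - ln (2 / \<delta>)"
      using n by (simp add: \<eta>)
    also have "exp (- ln (2 / \<delta>)) \<le> \<delta>"
      using \<open>0 < \<delta>\<close> by (simp add: exp_minus)
    finally show ?thesis .
  next
    \<comment> \<open>For \<open>u \<le> 0\<close> no value of a distribution function lies below
      \<open>u\<close>, so the count is 0.\<close>
    case False
    have "0 \<le> F s" for s by (simp add: F)
    then have "\<not> F s < u" for s using False by (meson not_le order.trans)
    then have "A = {}" by (simp add: A_def)
    moreover have "\<not> real n * (1 - \<alpha>) \<le> 0" using n \<open>\<alpha> < 1\<close> by (simp add: not_le)
    ultimately show ?thesis using \<open>0 < \<delta>\<close> by simp
  qed
  have "P.prob (space ?P - G\<^sub>0) \<le>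
      P.prob ({z \<in> space ?P. \<exists>j. t \<le> \<bar>T (map z [0..<n]) $ j - \<beta>\<^sub>0 $ j\<bar>} \<union>
        {z \<in> space ?P. real n * (1 - \<alpha>) \<le> (\<Sum>i<n. indicator A (z i))})"
    by (intro P.finite_measure_mono) (auto simp: G\<^sub>0_def)
  also have "\<dots> \<le> \<epsilon> + \<delta>"
    by (rule order.trans[OF measure_Un_le add_mono[OF bad_param bad_count]]) measurable
  finally have bad: "P.prob (space ?P - G\<^sub>0) \<le> \<epsilon> + \<delta>" .

  \<comment> \<open>The test-point event and its independence of the data\<close>
  define \<F> where "\<F> = vimage_algebra (space M) (data_vec n Z) (Pi\<^sub>M {..<n} (\<lambda>_. ?S))"
  define E where
    "E = {w \<in> space M. snd (Ztest w) \<notin> full_conformal Y T mu \<alpha> (data_list n Z w) (fst (Ztest w))}"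
  define G where "G = data_vec n Z -` G\<^sub>0 \<inter> space M"
  \<comment> \<open>A condition on the test point alone, so its preimage is independent of the data.
    By the integral transform its probability is at most \<open>1 - (u - L n * \<Delta>)\<close>,
    which is \<open>thr\<close>.\<close>
  define C\<^sub>0 where "C\<^sub>0 = {z \<in> space D. u - L n * \<Delta> \<le> F (R z)}"
  define C where "C = Ztest -` C\<^sub>0 \<inter> space M"
  have sets_\<F>: "sets \<F> = {data_vec n Z -` B \<inter> space M | B. B \<in> sets ?P}"
    unfolding \<F>_def sets_P by (rule sets_vimage_algebra2) (use rv_data in \<open>auto dest: measurable_space\<close>)
  have sub: "subalgebra M \<F>"
    using measurable_sets[OF rv_data] unfolding subalgebra_def sets_\<F> sets_P by (auto simp: \<F>_def)
  have C\<^sub>0 [measurable]: "C\<^sub>0 \<in> sets D"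
    unfolding C\<^sub>0_def by measurable
  have prob_C: "prob C \<le> thr"
  proof -
    have "prob C = D.prob C\<^sub>0"
      using measure_distr[OF rv_test, of C\<^sub>0] C\<^sub>0 sets_D by (simp add: C_def iid(3))
    also have "\<dots> \<le> 1 - (u - L n * \<Delta>)"
      unfolding C\<^sub>0_def F
      by (rule D.prob_cdf_ge[OF R F_cont])
        (use \<eta> \<open>0 < \<alpha>\<close> mult_pos_pos[OF \<open>0 < L n\<close> \<Delta>] in \<open>simp add: u_def\<close>)
    finally show ?thesis by (simp add: u_def thr_def)
  qed
  have indep: "prob (B \<inter> C) = prob B * prob C" if B: "B \<in> sets \<F>" for B
  proof -
    obtain B\<^sub>0 where B\<^sub>0: "B\<^sub>0 \<in> sets ?P" "B = data_vec n Z -` B\<^sub>0 \<inter> space M"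
      using B unfolding sets_\<F> by blast
    \<comment> \<open>Independence is used for two disjoint blocks of indices, so the test point is
      viewed as the block \<open>{n}\<close> and \<open>C\<^sub>0\<close> as a set of functions on
      it.\<close>
    define C\<^sub>1 where "C\<^sub>1 = (\<lambda>f. f n) -` C\<^sub>0 \<inter> space (Pi\<^sub>M {n} (\<lambda>_. ?S))"
    define X where "X = (\<lambda>w. \<lambda>i\<in>{n}. (Z(n := Ztest)) i w)"
    have "(\<lambda>f. f n) \<in> measurable (Pi\<^sub>M {n} (\<lambda>_. ?S)) ?S"
      by (rule measurable_component_singleton) simp
    then have C\<^sub>1: "C\<^sub>1 \<in> sets (Pi\<^sub>M {n} (\<lambda>_. ?S))"
      unfolding C\<^sub>1_def using C\<^sub>0 sets_D by (intro measurable_sets) simp_all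
    have X: "X w n = Ztest w" for w by (simp add: X_def)
    have "X \<in> measurable M (Pi\<^sub>M {n} (\<lambda>_. ?S))"
      unfolding X_def by (intro measurable_restrict rv) auto
    from measurable_space[OF this] have C: "X -` C\<^sub>1 \<inter> space M = C"
      by (auto simp: C_def C\<^sub>1_def X)
    have "indep_var (Pi\<^sub>M {..<n} (\<lambda>_. ?S)) (data_vec n Z) (Pi\<^sub>M {n} (\<lambda>_. ?S)) X"
      unfolding data_vec X_def by (rule indep_var_restrict[OF iid(1)]) auto
    from indep_varD[OF this, of B\<^sub>0 C\<^sub>1] B\<^sub>0 C\<^sub>1
    have "prob ((\<lambda>w. (data_vec n Z w, X w)) -` (B\<^sub>0 \<times> C\<^sub>1) \<inter> space M) = prob B * prob C"
      by (simp add: sets_P C)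
    moreover have "(\<lambda>w. (data_vec n Z w, X w)) -` (B\<^sub>0 \<times> C\<^sub>1) \<inter> space M = B \<inter> C"
      unfolding B\<^sub>0(2) C[symmetric] by auto
    ultimately show ?thesis by simp
  qed

  \<comment> \<open>Miscoverage on the good event\<close>
  have EGC: "E \<inter> G \<subseteq> C"
  proof
    fix w assume w: "w \<in> E \<inter> G"
    define z where "z = data_vec n Z w"
    define x y where "x = fst (Ztest w)" and "y = snd (Ztest w)"
    define zs where "zs = map z [0..<n]"
    have w_M: "w \<in> space M" and z_G: "z \<in> G\<^sub>0"
      using w by (auto simp: E_def G_def z_def)
    have z: "z \<in> space ?P" using z_G by (simp add: G\<^sub>0_def)
    have xy: "(x, y) \<in> space D" "x \<in> space MX" "y \<in> Y"
      using measurable_space[OF rv_test w_M] by (auto simp: x_def y_def space_S space_D)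
    have zs: "length zs = n" "set zs \<subseteq> space MX \<times> Y"
      using set_data[OF z] by (auto simp: zs_def)
    have "infnorm (T zs - \<beta>\<^sub>0) \<le> t"
      by (rule infnorm_le_cart) (use z_G z in \<open>auto simp: G\<^sub>0_def zs_def not_le intro: less_imp_le\<close>)
    then have "\<kappa>\<^sub>2 * infnorm (T zs - \<beta>\<^sub>0) \<le> \<kappa>\<^sub>2 * t"
      using \<open>0 \<le> \<kappa>\<^sub>2\<close> by (rule mult_left_mono)
    then have "sup_norm_on (space MX) (\<lambda>x. mu (T zs) x - m x) \<le> \<kappa>\<^sub>2 * t"
      unfolding m_def by (rule order.trans[OF A2(3)])
    then have near_mean: "\<bar>mu (T zs) x' - m x'\<bar> \<le> \<kappa>\<^sub>2 * t" if "x' \<in> space MX" for x'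
      unfolding m_def by (rule order.trans[OF abs_diff_le_sup_norm_on[OF assms(3) assms(3) that]])
    \<comment> \<open>The augmented sample has size \<open>n + 1\<close> with the test point at
      index \<open>n\<close>; deleting that entry recovers \<open>zs\<close>, so one use of
      stability at size \<open>n + 1\<close> suffices, whatever the value of
      \<open>y\<close>.\<close>
    have near_augmented: "\<bar>mu (T zs) x' - mu (T (zs @ [(x, y)])) x'\<bar> \<le> c (n + 1) / 2"
      if "x' \<in> space MX" for x'
    proof -
      have "sup_norm_on (space MX) (\<lambda>x'. mu (T (delete_nth n (zs @ [(x, y)]))) x' -
          mu (T (zs @ [(x, y)])) x') \<le> c (n + 1) / 2"
        using A1[of "n + 1" "zs @ [(x, y)]" n] \<open>2 \<le> n\<close> zs xy by simp
      then show ?thesis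
        using abs_diff_le_sup_norm_on[OF assms(3) assms(3) that, of "T zs" "T (zs @ [(x, y)])"]
          delete_nth_snoc[of zs "(x, y)"] zs(1) by simp
    qed
    have "\<Delta> / 2 = \<kappa>\<^sub>2 * t + c (n + 1) / 2"
      by (simp add: \<Delta>_def t_def)
    then have near: "\<bar>mu (T (zs @ [(x, y)])) x' - m x'\<bar> \<le> \<Delta> / 2" if "x' \<in> space MX" for x'
      using near_mean[OF that] near_augmented[OF that] by linarith
    have "y \<notin> full_conformal Y T mu \<alpha> zs x"
      using w by (simp add: E_def zs_def z_def x_def y_def data_list)
    then have "(1 - \<alpha>) * (real (length zs) + 1) \<le>
        real (length (filter (\<lambda>z. \<bar>snd z - m (fst z)\<bar> < \<bar>y - m x\<bar> + \<Delta>) zs))"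
      by (rule miscovered_imp_count) (use xy zs near \<open>0 < \<alpha>\<close> \<open>\<alpha> < 1\<close> in auto)
    then have count: "(1 - \<alpha>) * (real n + 1) \<le> (\<Sum>i<n. of_bool (R (z i) < R (x, y) + \<Delta>))"
      unfolding zs_def length_filter_map_upt by (simp add: R_def)
    \<comment> \<open>Otherwise every training residual below \<open>R (x, y) + \<Delta>\<close> has
      \<open>F\<close>-value below \<open>u\<close>, so its observation lies in \<open>A\<close>.
      Miscoverage then puts at least \<open>(1 - \<alpha>) * (n + 1)\<close> observations into
      \<open>A\<close>, more than the good event permits.\<close>
    have "u \<le> F (R (x, y) + \<Delta>)"
    proof (rule ccontr)
      assume less: "\<not> u \<le> F (R (x, y) + \<Delta>)"
      have "z i \<in> A" if "i < n" "R (z i) < R (x, y) + \<Delta>" for i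
      proof -
        have "F (R (z i)) \<le> F (R (x, y) + \<Delta>)"
          using that by (intro monoD[OF F_mono]) simp
        moreover have "z i \<in> space D"
          using z that by (auto simp: space_PiM)
        ultimately show ?thesis using less by (simp add: A_def)
      qed
      then have "(\<Sum>i<n. of_bool (R (z i) < R (x, y) + \<Delta>)) \<le> (\<Sum>i<n. indicat_real A (z i))"
        by (intro sum_mono) auto
      also have "\<dots> < real n * (1 - \<alpha>)"
        using z_G z by (simp add: G\<^sub>0_def not_le)
      also have "\<dots> \<le> (1 - \<alpha>) * (real n + 1)"
        using \<open>\<alpha> < 1\<close> by (simp add: algebra_simps)
      finally show False using count by simp
    qed
    \<comment> \<open>The bounded density removes the shift \<open>\<Delta>\<close> at a cost of at
      most \<open>L n * \<Delta>\<close> in probability.\<close>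
    moreover have "F (R (x, y) + \<Delta>) - F (R (x, y)) \<le> L n * \<Delta>"
      using has_density_increment(2)[OF f, of "R (x, y)" "R (x, y) + \<Delta>"] \<Delta> by simp
    ultimately have "u - L n * \<Delta> \<le> F (R (x, y))" by linarith
    then show "w \<in> C"
      using xy(1) w_M by (simp add: C_def C\<^sub>0_def x_def y_def)
  qed

  \<comment> \<open>Conditional probability of miscoverage\<close>
  have miscov: "miscoverage M MX Y T mu \<alpha> n Z Ztest = real_cond_exp M \<F> (indicat_real E)"
    by (simp add: miscoverage_def cond_prob_data_def \<F>_def E_def)
  have "\<P>(w in M. thr < real_cond_exp M \<F> (indicat_real E) w) \<le> \<epsilon> + \<delta>"
  proof (cases "E \<in> events")
    case True
    have "G \<in> sets \<F>" unfolding sets_\<F> G_def using G\<^sub>0 by blast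
    moreover have "C \<in> events"
      unfolding C_def using C\<^sub>0 sets_D by (intro measurable_sets[OF rv_test]) simp
    ultimately have "\<P>(w in M. thr < real_cond_exp M \<F> (indicat_real E) w) \<le> prob (space M - G)"
      using indep by (rule prob_real_cond_exp_indicator_gt[OF sub True _ _ EGC _ prob_C])
    also have "space M - G = data_vec n Z -` (space ?P - G\<^sub>0) \<inter> space M"
      using measurable_space[OF rv_data] unfolding G_def space_P by auto
    also have "prob \<dots> = P.prob (space ?P - G\<^sub>0)"
      by (rule prob_data) measurable
    finally show ?thesis using bad by simp
  next
    case False
    have "\<not> thr < real_cond_exp M \<F> (indicat_real E) w" for w
      using real_cond_exp_indicator_nonmeasurable[OF _ False, of \<F> w] thr by (auto simp: E_def)
    then show ?thesis using \<open>0 < \<epsilon>\<close> \<open>0 < \<delta>\<close> by simp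
  qed
  then show ?thesis
    unfolding miscov by (simp add: thr_def \<eta>_def \<Delta>_def r_def)
qed

end
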